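(* Let $(\Omega,f,w)$ be an invertible system. Let $(X,\|\cdot\|)$ be a Banach space of continuous functions $\varphi:\Omega\to\mathbb{K}$ such that the following conditions hold: \begin{itemize} \item[(A1)] the weighted composition operator $C_{w,f}:X\to X$, $\varphi\mapsto(\varphi\circ f)w$, is an invertible operator; \item[(A2)] $\|(C_{w,f})^n(\varphi)\|\le \|w^{[n]}\|_{\infty,\,f^{-n}(\operatorname{supp}(\varphi))}\,\|\varphi\|$ for all $\varphi\in X$ and $n\in\mathbb{Z}$; \item[(A3)] there exist functions $\rho_-,\rho_+:\Omega\to\mathbb{K}$ satisfying $\rho_{\pm}\varphi\in X$ and $\|\rho_{\pm}\varphi\|\le\|\varphi\|$ for all $\varphi\in X$, and $\rho_-+\rho_+\equiv1$. \end{itemize} If one of the following conditions holds: \begin{itemize} \item[(A)] $\lim_{n\to\infty}\|w^{[n]}\|_{\infty}^{\frac1n}<1$; \item[(B)] $\lim_{n\to\infty}\|w^{[-n]}\|_{\infty}^{\frac1n}<1$; \item[(C)] $\lim_{n\to\infty}\|w^{[n]}\|_{\infty,\,f^{-n}(\operatorname{supp}(\rho_-))}^{\frac1n}<1$ and $\lim_{n\to\infty}\|w^{[-n]}\|_{\infty,\,f^{n}(\operatorname{supp}(\rho_+))}^{\frac1n}<1$, \end{itemize} then $C_{w,f}$ has the shadowing property.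
   Context: $\mathbb{K}$ is $\mathbb{R}$ or $\mathbb{C}$. An (invertible) operator on a Banach space is a continuous (invertible) linear self-map. Shadowing: an invertible operator $T$ on a Banach space $X$ has the shadowing property if for every $\varepsilon>0$ there is $\delta>0$ such that for every sequence $(x_j)_{j\in\mathbb{Z}}$ in $X$ with $\|T(x_j)-x_{j+1}\|\le\delta$ for all $j\in\mathbb{Z}$ there is $x\in X$ with $\|x_j-T^j(x)\|<\varepsilon$ for all $j\in\mathbb{Z}$. Invertible system $(\Omega,f,w)$: $\Omega$ is a locally compact Hausdorff space; $w:\Omega\to\mathbb{K}$ is continuous with $0<\inf_{x\in\Omega}|w(x)|\le\sup_{x\in\Omega}|w(x)|<\infty$; $f:\Omega\to\Omega$ is a homeomorphism. Functions $w^{[n]}$, $n\in\mathbb{Z}$: $w^{[0]}=1$, $w^{[1]}=w$, $w^{[-1]}=\frac{1}{w\circ f^{-1}}$, and for $n\ge2$, $w^{[n]}=(w\circ f^{n-1})\,w^{[n-1]}$ and $w^{[-n]}=\frac{1}{w\circ f^{-n}}\,w^{[-(n-1)]}$. For a bounded map $\varphi:\Omega\to\mathbb{K}$ and $B\subset\Omega$, $\|\varphi\|_{\infty,B}=\sup_{x\in B}|\varphi(x)|$ (equal to $0$ if $B=\varnothing$), and $\|\varphi\|_\infty=\|\varphi\|_{\infty,\Omega}$. The support of $\varphi:\Omega\to\mathbb{K}$ is $\operatorname{supp}\varphi=\overline{\{x\in\Omega:\varphi(x)\ne0\}}$. *)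

theory Defs
  imports "HOL-Analysis.Analysis" "HOL-Library.Function_Algebras"
begin

text \<open>
  The scalar field is a type of class \<open>real_normed_field\<close>. Norms in this class are
  multiplicative, so by the Gelfand--Mazur theorem its only members, up to isometric
  isomorphism, are the real and the complex numbers.
\<close>

locale banach_space_on = vector_space smul
  for smul :: "'k::real_normed_field \<Rightarrow> 'v::ab_group_add \<Rightarrow> 'v" +
  fixes X :: "'v set" and N :: "'v \<Rightarrow> real"
  assumes carrier_subspace: "subspace X"
    and norm_nonneg: "x \<in> X \<Longrightarrow> 0 \<le> N x"
    and norm_eq_zero: "x \<in> X \<Longrightarrow> N x = 0 \<longleftrightarrow> x = 0"
    and norm_scale: "x \<in> X \<Longrightarrow> N (smul c x) = norm c * N x"
    and norm_triangle: "x \<in> X \<Longrightarrow> y \<in> X \<Longrightarrow> N (x + y) \<le> N x + N y"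
    and complete:
      "(\<And>n. s n \<in> X) \<Longrightarrow> (\<And>e. e > 0 \<Longrightarrow> \<exists>M. \<forall>m\<ge>M. \<forall>n\<ge>M. N (s m - s n) < e) \<Longrightarrow>
        \<exists>l\<in>X. (\<lambda>n::nat. N (s n - l)) \<longlonglongrightarrow> 0"

definition fun_scale :: "'k::real_normed_field \<Rightarrow> ('a \<Rightarrow> 'k) \<Rightarrow> 'a \<Rightarrow> 'k"
  where "fun_scale c \<phi> = (\<lambda>x. c * \<phi> x)"

lemma vector_space_fun_scale: "vector_space (fun_scale :: 'k::real_normed_field \<Rightarrow> ('a \<Rightarrow> 'k) \<Rightarrow> _)"
  by unfold_locales (auto simp: fun_scale_def fun_eq_iff algebra_simps)

locale banach_function_space = banach_space_on fun_scale X N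
  for X :: "('a::topological_space \<Rightarrow> 'k::real_normed_field) set" and N +
  assumes continuous_members: "\<phi> \<in> X \<Longrightarrow> continuous_on UNIV \<phi>"

text \<open>Continuity of the inverse is not required: it follows from the open mapping theorem.\<close>

definition invertible_operator_on ::
    "('k \<Rightarrow> 'v::ab_group_add \<Rightarrow> 'v) \<Rightarrow> 'v set \<Rightarrow> ('v \<Rightarrow> real) \<Rightarrow> ('v \<Rightarrow> 'v) \<Rightarrow> bool"
  where "invertible_operator_on smul X N T \<longleftrightarrow>
    bij_betw T X X \<and>
    (\<forall>x\<in>X. \<forall>y\<in>X. T (x + y) = T x + T y) \<and>
    (\<forall>c. \<forall>x\<in>X. T (smul c x) = smul c (T x)) \<and>
    (\<forall>x\<in>X. \<forall>e>0. \<exists>d>0. \<forall>y\<in>X. N (y - x) < d \<longrightarrow> N (T y - T x) < e)"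

text \<open>Integer iterates of a map that is a bijection of \<open>X\<close> onto itself.\<close>

definition int_iterate_on :: "'v set \<Rightarrow> ('v \<Rightarrow> 'v) \<Rightarrow> int \<Rightarrow> 'v \<Rightarrow> 'v"
  where "int_iterate_on X T n =
    (if 0 \<le> n then T ^^ nat n else inv_into X T ^^ nat (- n))"

definition shadowing_property_on ::
    "'v::ab_group_add set \<Rightarrow> ('v \<Rightarrow> real) \<Rightarrow> ('v \<Rightarrow> 'v) \<Rightarrow> bool"
  where "shadowing_property_on X N T \<longleftrightarrow>
    (\<forall>\<epsilon>>0. \<exists>\<delta>>0. \<forall>x :: int \<Rightarrow> 'v.
      (\<forall>j. x j \<in> X) \<and> (\<forall>j. N (T (x j) - x (j + 1)) \<le> \<delta>) \<longrightarrow>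
      (\<exists>y\<in>X. \<forall>j. N (x j - int_iterate_on X T j y) < \<epsilon>))"

locale invertible_system =
  fixes f :: "'a::t2_space \<Rightarrow> 'a" and w :: "'a \<Rightarrow> 'k::real_normed_field"
  assumes locally_compact: "locally_compact_space (euclidean :: 'a topology)"
    and weight_continuous: "continuous_on UNIV w"
    and weight_inf: "0 < (INF x. norm (w x))"
    and weight_sup: "bdd_above (range (\<lambda>x. norm (w x)))"
    and homeo: "homeomorphism UNIV UNIV f (inv f)"

definition weighted_comp :: "('a \<Rightarrow> 'k::times) \<Rightarrow> ('a \<Rightarrow> 'a) \<Rightarrow> ('a \<Rightarrow> 'k) \<Rightarrow> 'a \<Rightarrow> 'k"
  where "weighted_comp w f \<phi> = (\<lambda>x. \<phi> (f x) * w x)"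

primrec weight_pos :: "('a \<Rightarrow> 'a) \<Rightarrow> ('a \<Rightarrow> 'k::field) \<Rightarrow> nat \<Rightarrow> 'a \<Rightarrow> 'k" where
  "weight_pos f w 0 = (\<lambda>x. 1)"
| "weight_pos f w (Suc n) = (\<lambda>x. w ((f ^^ n) x) * weight_pos f w n x)"

primrec weight_neg :: "('a \<Rightarrow> 'a) \<Rightarrow> ('a \<Rightarrow> 'k::field) \<Rightarrow> nat \<Rightarrow> 'a \<Rightarrow> 'k" where
  "weight_neg f w 0 = (\<lambda>x. 1)"
| "weight_neg f w (Suc n) = (\<lambda>x. 1 / w ((inv f ^^ Suc n) x) * weight_neg f w n x)"

text \<open>The functions usually written $w^{[n]}$, for an integer \<open>n\<close>.\<close>

definition weight_iter :: "('a \<Rightarrow> 'a) \<Rightarrow> ('a \<Rightarrow> 'k::field) \<Rightarrow> int \<Rightarrow> 'a \<Rightarrow> 'k"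
  where "weight_iter f w n =
    (if 0 \<le> n then weight_pos f w (nat n) else weight_neg f w (nat (- n)))"

text \<open>Used only for bounded \<open>\<phi>\<close>; the supremum of an unbounded set of reals is unspecified.\<close>

definition sup_norm_on :: "'a set \<Rightarrow> ('a \<Rightarrow> 'k::real_normed_vector) \<Rightarrow> real"
  where "sup_norm_on B \<phi> = (if B = {} then 0 else (SUP x\<in>B. norm (\<phi> x)))"

definition supp :: "('a::topological_space \<Rightarrow> 'k::zero) \<Rightarrow> 'a set"
  where "supp \<phi> = closure {x. \<phi> x \<noteq> 0}"

end

theory Submission
  imports Defs
begin

text \<open>
  Put \<open>T = weighted_comp w f\<close>. If \<open>z j = x (j + 1) - T (x j)\<close> are the errors of a pseudo-orbit,
  then the deviation \<open>d j = x j - T\<^sup>j y\<close> from a true orbit obeys \<open>d (j + 1) = T (d j) + z j\<close>;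
  conversely, any solution \<open>d\<close> of this recurrence makes \<open>x - d\<close> a true orbit. So shadowing asks
  for a solution of the recurrence that is bounded by a multiple of the size of \<open>z\<close>.

  Suppose that a splitting \<open>z = P z + Q z\<close> is such that the forward iterates of \<open>T\<close> are summably small on
  the range of \<open>P\<close> and the backward iterates are summably small on the range of \<open>Q\<close>. Then the
  errors \<open>P z\<close> can be left to decay in the future, and the errors \<open>Q z\<close> can be cancelled in
  advance at a cost that decays with the delay until they occur:
  \[ d_j = \sum_{n \ge 0} T^n (P z_{j-1-n}) - \sum_{n \ge 1} T^{-n} (Q z_{j-1+n}). \]
  Each error is split only once, when it occurs, and both parts then travel under \<open>T\<close> itself, so
  the bounds are only asked of iterates applied directly after the splitting. This is
  \<open>shadowing_of_summable_splitting\<close>, a statement about arbitrary Banach spaces.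

  For the weighted composition operator the splitting is multiplication by \<open>\<rho>m\<close> and \<open>\<rho>p\<close>, or the
  trivial one with \<open>P\<close> or \<open>Q\<close> the identity. As the support of \<open>\<rho>m * z\<close> lies in that of \<open>\<rho>m\<close>, the
  norm estimate for \<open>T\<^sup>n\<close> bounds the terms by suprema of the iterated weights over images of that
  fixed set, and the root test makes these suprema summable.
\<close>

section \<open>Series in a Banach space given by a carrier\<close>

context banach_space_on
begin

lemma carrier_zero: "0 \<in> X"
  and carrier_add: "x \<in> X \<Longrightarrow> y \<in> X \<Longrightarrow> x + y \<in> X"
  and carrier_diff: "x \<in> X \<Longrightarrow> y \<in> X \<Longrightarrow> x - y \<in> X"
  and carrier_sum: "(\<And>i. i \<in> A \<Longrightarrow> s i \<in> X) \<Longrightarrow> sum s A \<in> X"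
  using carrier_subspace
  by (auto intro: subspace_0 subspace_add subspace_diff subspace_sum)

lemma norm_zero: "N 0 = 0"
  using norm_eq_zero[OF carrier_zero] by simp

lemma norm_minus_commute:
  assumes "x \<in> X" "y \<in> X"
  shows "N (x - y) = N (y - x)"
  using norm_scale[OF carrier_diff[OF assms], of "- 1"] by simp

lemma norm_diff_triangle:
  assumes "x \<in> X" "y \<in> X" "z \<in> X"
  shows "N (x - z) \<le> N (x - y) + N (y - z)"
  using norm_triangle[OF carrier_diff[OF assms(1,2)] carrier_diff[OF assms(2,3)]] by simp

lemma norm_diff_le:
  assumes "x \<in> X" "y \<in> X"
  shows "N (x - y) \<le> N x + N y"
  using norm_diff_triangle[OF assms(1) carrier_zero assms(2)]
    norm_minus_commute[OF carrier_zero assms(2)] by simp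

lemma norm_sum_le:
  assumes "\<And>i. i \<in> A \<Longrightarrow> s i \<in> X" "\<And>i. i \<in> A \<Longrightarrow> N (s i) \<le> a i"
  shows "N (sum s A) \<le> sum a A"
  using assms
proof (induction A rule: infinite_finite_induct)
  case (insert i A)
  have "N (s i + sum s A) \<le> N (s i) + N (sum s A)"
    using insert by (intro norm_triangle carrier_sum) auto
  also have "\<dots> \<le> a i + sum a A"
    using insert by (intro add_mono) auto
  finally show ?case using insert by simp
qed (auto simp: norm_zero)

definition norm_sums :: "(nat \<Rightarrow> 'v) \<Rightarrow> 'v \<Rightarrow> bool"
  where "norm_sums s l \<longleftrightarrow> l \<in> X \<and> (\<lambda>n. N (sum s {..<n} - l)) \<longlonglongrightarrow> 0"

lemma norm_sums_unique:
  assumes s: "\<And>n. s n \<in> X" and l: "norm_sums s l" and l': "norm_sums s l'"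
  shows "l = l'"
proof -
  have in_X: "l \<in> X" "l' \<in> X"
    using l l' by (auto simp: norm_sums_def)
  have S: "sum s {..<n} \<in> X" for n
    using s by (intro carrier_sum)
  have "N (l - l') \<le> N (sum s {..<n} - l) + N (sum s {..<n} - l')" for n
    using norm_diff_triangle[OF in_X(1) S in_X(2), of n] norm_minus_commute[OF in_X(1) S, of n]
    by simp
  moreover have "(\<lambda>n. N (sum s {..<n} - l) + N (sum s {..<n} - l')) \<longlonglongrightarrow> 0 + 0"
    using l l' by (intro tendsto_add) (auto simp: norm_sums_def)
  ultimately have "N (l - l') \<le> 0"
    using LIMSEQ_le_const by fastforce
  then show ?thesis
    using norm_nonneg norm_eq_zero[of "l - l'"] carrier_diff[OF in_X]
    by (metis eq_iff_diff_eq_0 order_antisym)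
qed

lemma norm_sums_Suc:
  assumes "s 0 \<in> X" and l: "norm_sums (\<lambda>n. s (Suc n)) l"
  shows "norm_sums s (s 0 + l)"
proof -
  have "(\<lambda>n. N (sum s {..<Suc n} - (s 0 + l))) \<longlonglongrightarrow> 0"
    using l by (simp add: norm_sums_def sum.lessThan_Suc_shift algebra_simps del: sum.lessThan_Suc)
  then show ?thesis
    using assms LIMSEQ_imp_Suc[of "\<lambda>n. N (sum s {..<n} - (s 0 + l))"]
    by (auto simp: norm_sums_def carrier_add)
qed

text \<open>
  Completeness enters only through this comparison test; the bound on the sum is what makes the
  solutions built from such series uniformly bounded in time.
\<close>

lemma norm_sums_of_dominated:
  assumes s: "\<And>n. s n \<in> X" and le: "\<And>n. N (s n) \<le> a n" and a: "summable a"
  obtains l where "norm_sums s l" "N l \<le> suminf a"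
proof -
  have S: "sum s {..<n} \<in> X" for n
    using s by (intro carrier_sum)
  have a_nonneg: "0 \<le> a n" for n
    using norm_nonneg[OF s] le order_trans by blast
  have "\<exists>M. \<forall>m\<ge>M. \<forall>n\<ge>M. N (sum s {..<m} - sum s {..<n}) < e" if "e > 0" for e
  proof -
    from a that obtain M where M: "\<And>m n. M \<le> m \<Longrightarrow> \<bar>sum a {m..<n}\<bar> < e"
      unfolding summable_Cauchy real_norm_def by meson
    have ordered: "N (sum s {..<n} - sum s {..<m}) < e" if "M \<le> m" "m \<le> n" for m n
    proof -
      have "sum s {..<n} - sum s {..<m} = sum s {m..<n}"
        using sum_diff_nat_ivl[of 0 m n s] that by (simp add: atLeast0LessThan)
      moreover have "N (sum s {m..<n}) \<le> sum a {m..<n}"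
        using s le by (intro norm_sum_le)
      ultimately show ?thesis using M[OF that(1), of n] by simp
    qed
    have "N (sum s {..<m} - sum s {..<n}) < e" if "M \<le> m" "M \<le> n" for m n
      using ordered[of m n] ordered[of n m] norm_minus_commute[OF S S, of m n] that
      by (cases "m \<le> n") auto
    then show ?thesis by blast
  qed
  then obtain l where l: "l \<in> X" "(\<lambda>n. N (sum s {..<n} - l)) \<longlonglongrightarrow> 0"
    using complete[of "\<lambda>n. sum s {..<n}"] S by blast
  have "N l \<le> N (sum s {..<n} - l) + suminf a" for n
  proof -
    have "N l \<le> N (l - sum s {..<n}) + N (sum s {..<n})"
      using norm_triangle[OF carrier_diff[OF l(1) S] S, of n n] by simp
    moreover have "N (sum s {..<n}) \<le> sum a {..<n}"
      using s le by (intro norm_sum_le)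
    moreover have "sum a {..<n} \<le> suminf a"
      using a_nonneg by (intro sum_le_suminf a) auto
    ultimately show ?thesis
      using norm_minus_commute[OF l(1) S, of n] by simp
  qed
  moreover have "(\<lambda>n. N (sum s {..<n} - l) + suminf a) \<longlonglongrightarrow> 0 + suminf a"
    by (intro tendsto_add l tendsto_const)
  ultimately have "N l \<le> suminf a"
    using LIMSEQ_le_const by fastforce
  with l that show ?thesis by (auto simp: norm_sums_def)
qed

end

section \<open>Shadowing by splitting the errors\<close>

locale invertible_banach_operator = banach_space_on smul X N
  for smul :: "'k::real_normed_field \<Rightarrow> 'v::ab_group_add \<Rightarrow> 'v" and X N +
  fixes T :: "'v \<Rightarrow> 'v"
  assumes invertible: "invertible_operator_on smul X N T"
begin

lemma bij: "bij_betw T X X"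
  and T_add: "x \<in> X \<Longrightarrow> y \<in> X \<Longrightarrow> T (x + y) = T x + T y"
  and T_continuous:
    "x \<in> X \<Longrightarrow> e > 0 \<Longrightarrow> \<exists>d>0. \<forall>y\<in>X. N (y - x) < d \<longrightarrow> N (T y - T x) < e"
  using invertible by (auto simp: invertible_operator_on_def)

lemma T_in: "x \<in> X \<Longrightarrow> T x \<in> X"
  using bij by (auto simp: bij_betw_def)

lemma inv_in: "x \<in> X \<Longrightarrow> inv_into X T x \<in> X"
  using bij by (metis bij_betw_def inv_into_into)

lemma T_inv: "x \<in> X \<Longrightarrow> T (inv_into X T x) = x"
  using bij by (metis bij_betw_def f_inv_into_f)

lemma inv_T: "x \<in> X \<Longrightarrow> inv_into X T (T x) = x"
  using bij by (metis bij_betw_def inv_into_f_f)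

lemma T_diff:
  assumes "x \<in> X" "y \<in> X"
  shows "T (x - y) = T x - T y"
  using T_add[OF carrier_diff[OF assms] assms(2)] by (simp add: algebra_simps)

lemma T_zero: "T 0 = 0"
  using T_diff[OF carrier_zero carrier_zero] by simp

lemma T_sum: "(\<And>i. i \<in> A \<Longrightarrow> s i \<in> X) \<Longrightarrow> T (sum s A) = (\<Sum>i\<in>A. T (s i))"
  by (induction A rule: infinite_finite_induct) (auto simp: T_zero T_add carrier_sum)

lemma iterate_in: "x \<in> X \<Longrightarrow> (T ^^ n) x \<in> X"
  by (induction n) (auto simp: T_in)

lemma inv_iterate_in: "x \<in> X \<Longrightarrow> (inv_into X T ^^ n) x \<in> X"
  by (induction n) (auto simp: inv_in)

text \<open>
  Continuity and additivity of \<open>T\<close> let it act term by term on a series; this turns a shift of the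
  summation index into the recurrence for the deviations.
\<close>

lemma norm_sums_image:
  assumes s: "\<And>n. s n \<in> X" and l: "norm_sums s l"
  shows "norm_sums (\<lambda>n. T (s n)) (T l)"
proof -
  have in_X: "l \<in> X" "sum s {..<n} \<in> X" for n
    using s l by (auto simp: norm_sums_def intro: carrier_sum)
  have "(\<lambda>n. N (T (sum s {..<n}) - T l)) \<longlonglongrightarrow> 0"
  proof (rule LIMSEQ_I)
    fix e :: real
    assume "e > 0"
    with T_continuous in_X(1) obtain d
      where d: "d > 0" "\<And>y. y \<in> X \<Longrightarrow> N (y - l) < d \<Longrightarrow> N (T y - T l) < e"
      by meson
    have "(\<lambda>n. N (sum s {..<n} - l)) \<longlonglongrightarrow> 0"
      using l by (simp add: norm_sums_def)
    from LIMSEQ_D[OF this d(1)] obtain M where "\<And>n. n \<ge> M \<Longrightarrow> N (sum s {..<n} - l) < d"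
      by (metis abs_less_iff diff_zero real_norm_def)
    then have "N (T (sum s {..<n}) - T l) < e" if "n \<ge> M" for n
      using d(2)[OF in_X(2)] that by blast
    moreover have "0 \<le> N (T (sum s {..<n}) - T l)" for n
      using in_X by (intro norm_nonneg carrier_diff T_in)
    ultimately show "\<exists>M. \<forall>n\<ge>M. norm (N (T (sum s {..<n}) - T l) - 0) < e"
      by auto
  qed
  then show ?thesis
    using in_X s by (simp add: norm_sums_def T_sum T_in)
qed

lemma int_iterate_on_int: "int_iterate_on X T (int n) = T ^^ n"
  by (simp add: int_iterate_on_def)

lemma int_iterate_on_minus_int: "int_iterate_on X T (- int n) = inv_into X T ^^ n"
  by (cases "n = 0") (simp_all add: int_iterate_on_def)

lemma orbit_eq_iterate:
  assumes e: "\<And>j. e j \<in> X" and step: "\<And>j. e (j + 1) = T (e j)"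
  shows "e j = int_iterate_on X T j (e 0)"
proof -
  have pos: "e (int n) = (T ^^ n) (e 0)" for n
  proof (induction n)
    case (Suc n)
    then show ?case
      using step[of "int n"] by (simp add: add.commute)
  qed simp
  have neg: "e (- int n) = (inv_into X T ^^ n) (e 0)" for n
  proof (induction n)
    case (Suc n)
    have "e (- int n) = T (e (- int (Suc n)))"
      using step[of "- int (Suc n)"] by simp
    then have "e (- int (Suc n)) = inv_into X T (e (- int n))"
      by (simp add: inv_T e)
    with Suc show ?case by simp
  qed simp
  show ?thesis
    using pos[of "nat j"] neg[of "nat (- j)"] by (cases "0 \<le> j") (simp_all add: int_iterate_on_def)
qed

text \<open>
  The causal solution: each error is propagated forward from the time at which it occurs.
\<close>

lemma forward_solution:
  assumes z: "\<And>j. z j \<in> X"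
    and le: "\<And>n j. N ((T ^^ n) (z j)) \<le> a n" and a: "summable a"
  obtains u where "\<And>j. u j \<in> X" "\<And>j. N (u j) \<le> suminf a" "\<And>j::int. u (j + 1) = T (u j) + z j"
proof -
  define s where "s j n = (T ^^ n) (z (j - 1 - int n))" for j n
  have s: "s j n \<in> X" for j n
    by (simp add: s_def iterate_in z)
  have s_le: "N (s j n) \<le> a n" for j n
    by (simp add: s_def le)
  have "\<exists>l. norm_sums (s j) l \<and> N l \<le> suminf a" for j
    by (rule norm_sums_of_dominated[of "s j", OF s s_le a]) blast
  then obtain u where u: "\<And>j. norm_sums (s j) (u j)" "\<And>j. N (u j) \<le> suminf a"
    by metis
  show ?thesis
  proof
    show "u j \<in> X" for j
      using u(1) by (simp add: norm_sums_def)
    show "N (u j) \<le> suminf a" for j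
      by (rule u(2))
    fix j
    have "s (j + 1) (Suc n) = T (s j n)" for n
      by (simp add: s_def algebra_simps)
    then have "norm_sums (\<lambda>n. s (j + 1) (Suc n)) (T (u j))"
      using norm_sums_image[OF s u(1)] by simp
    then have "norm_sums (s (j + 1)) (s (j + 1) 0 + T (u j))"
      by (intro norm_sums_Suc s)
    then show "u (j + 1) = T (u j) + z j"
      using norm_sums_unique[OF s u(1)] by (simp add: s_def add.commute)
  qed
qed

text \<open>
  The anticausal solution, up to sign: \<open>- v j\<close> cancels in advance all errors still to come. Only
  powers of the inverse from the first on occur, because an error made in the step from \<open>j\<close> to
  \<open>j + 1\<close> has to be cancelled already at time \<open>j\<close>.
\<close>

lemma backward_solution:
  assumes z: "\<And>j. z j \<in> X"
    and le: "\<And>n j. N ((inv_into X T ^^ n) (z j)) \<le> b n" and b: "summable b"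
  obtains v where "\<And>j. v j \<in> X" "\<And>j. N (v j) \<le> (\<Sum>n. b (Suc n))"
    "\<And>j::int. v (j + 1) = T (v j) - z j"
proof -
  define s where "s j n = (inv_into X T ^^ Suc n) (z (j + int n))" for j n
  have s: "s j n \<in> X" for j n
    unfolding s_def by (intro inv_iterate_in z)
  have s_le: "N (s j n) \<le> b (Suc n)" for j n
    unfolding s_def by (rule le)
  have b_Suc: "summable (\<lambda>n. b (Suc n))"
    using b by (simp add: summable_Suc_iff)
  have "\<exists>l. norm_sums (s j) l \<and> N l \<le> (\<Sum>n. b (Suc n))" for j
    by (rule norm_sums_of_dominated[of "s j", OF s s_le b_Suc]) blast
  then obtain v where v: "\<And>j. norm_sums (s j) (v j)" "\<And>j. N (v j) \<le> (\<Sum>n. b (Suc n))"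
    by metis
  show ?thesis
  proof
    show "v j \<in> X" for j
      using v(1) by (simp add: norm_sums_def)
    show "N (v j) \<le> (\<Sum>n. b (Suc n))" for j
      by (rule v(2))
    fix j
    have T_s: "T (s j n) = (inv_into X T ^^ n) (z (j + int n))" for n
      by (simp add: s_def T_inv inv_iterate_in z)
    have "T (s j (Suc n)) = s (j + 1) n" for n
      by (simp only: T_s) (simp add: s_def algebra_simps)
    then have "norm_sums (\<lambda>n. T (s j n)) (T (s j 0) + v (j + 1))"
      using v(1) by (intro norm_sums_Suc T_in s) simp
    then have "T (v j) = T (s j 0) + v (j + 1)"
      using norm_sums_unique[OF T_in[OF s] norm_sums_image[OF s v(1)]] by blast
    then show "v (j + 1) = T (v j) - z j"
      using T_s[of 0] by simp
  qed
qed

text \<open>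
  The causal solution for the errors \<open>P z\<close> plus the anticausal one for the errors \<open>Q z\<close> solves the
  recurrence for \<open>z\<close>. Since the bounds are linear in the size of the errors, the admissible error
  \<open>\<delta>\<close> is a constant multiple of \<open>\<epsilon>\<close>.
\<close>

theorem shadowing_of_summable_splitting:
  assumes P: "\<And>x. x \<in> X \<Longrightarrow> P x \<in> X" and Q: "\<And>x. x \<in> X \<Longrightarrow> Q x \<in> X"
    and split: "\<And>x. x \<in> X \<Longrightarrow> P x + Q x = x"
    and forward: "\<And>n x. x \<in> X \<Longrightarrow> N ((T ^^ n) (P x)) \<le> a n * N x" and a: "summable a"
    and backward: "\<And>n x. x \<in> X \<Longrightarrow> N ((inv_into X T ^^ n) (Q x)) \<le> b n * N x" and b: "summable b"
    and nonneg: "\<And>n. 0 \<le> a n" "\<And>n. 0 \<le> b n"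
  shows "shadowing_property_on X N T"
  unfolding shadowing_property_on_def
proof (intro allI impI)
  fix \<epsilon> :: real
  assume "\<epsilon> > 0"
  define C where "C = suminf a + (\<Sum>n. b (Suc n))"
  have b_Suc: "summable (\<lambda>n. b (Suc n))"
    using b by (simp add: summable_Suc_iff)
  have "C \<ge> 0"
    using a b_Suc nonneg by (auto simp: C_def intro!: add_nonneg_nonneg suminf_nonneg)
  \<comment> \<open>The summand \<open>1\<close> keeps the quotient meaningful and the final inequality strict.\<close>
  define \<delta> where "\<delta> = \<epsilon> / (C + 1)"
  have "\<delta> > 0" and "C * \<delta> < \<epsilon>"
    using \<open>\<epsilon> > 0\<close> \<open>C \<ge> 0\<close> by (auto simp: \<delta>_def field_simps)
  have "\<exists>y\<in>X. \<forall>j. N (x j - int_iterate_on X T j y) < \<epsilon>"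
    if x: "\<forall>j. x j \<in> X" and pseudo: "\<forall>j. N (T (x j) - x (j + 1)) \<le> \<delta>" for x :: "int \<Rightarrow> 'v"
  proof -
    define z where "z j = x (j + 1) - T (x j)" for j
    have z: "z j \<in> X" "N (z j) \<le> \<delta>" for j
      using x pseudo norm_minus_commute[of "x (j + 1)" "T (x j)"]
      by (auto simp: z_def carrier_diff T_in)
    have "N ((T ^^ n) (P (z j))) \<le> a n * \<delta>" for n j
      using forward[OF z(1)] mult_left_mono[OF z(2) nonneg(1)] order_trans by blast
    then obtain u where u: "\<And>j. u j \<in> X" "\<And>j. N (u j) \<le> (\<Sum>n. a n * \<delta>)"
      "\<And>j. u (j + 1) = T (u j) + P (z j)"
      by (rule forward_solution[of "\<lambda>j. P (z j)", OF P[OF z(1)] _ summable_mult2[OF a]]) blast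
    have "N ((inv_into X T ^^ n) (Q (z j))) \<le> b n * \<delta>" for n j
      using backward[OF z(1)] mult_left_mono[OF z(2) nonneg(2)] order_trans by blast
    then obtain v where v: "\<And>j. v j \<in> X" "\<And>j. N (v j) \<le> (\<Sum>n. b (Suc n) * \<delta>)"
      "\<And>j. v (j + 1) = T (v j) - Q (z j)"
      by (rule backward_solution[of "\<lambda>j. Q (z j)", OF Q[OF z(1)] _ summable_mult2[OF b]]) blast
    define e where "e j = x j - (u j - v j)" for j
    have e: "e j \<in> X" for j
      using x u(1) v(1) by (simp add: e_def carrier_diff)
    have "e (j + 1) = T (e j)" for j
    proof -
      have "e (j + 1) = z j + T (x j) - (T (u j) + P (z j) - (T (v j) - Q (z j)))"
        by (simp add: e_def u(3) v(3) z_def)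
      also have "\<dots> = (T (x j) - (T (u j) - T (v j))) + (z j - (P (z j) + Q (z j)))"
        by (simp add: algebra_simps)
      also have "\<dots> = T (e j)"
        using x by (simp add: e_def T_diff carrier_diff u(1) v(1) split[OF z(1)])
      finally show ?thesis .
    qed
    then have orbit: "int_iterate_on X T j (e 0) = e j" for j
      by (rule orbit_eq_iterate[OF e, symmetric])
    have "N (x j - e j) < \<epsilon>" for j
    proof -
      have "N (x j - e j) \<le> N (u j) + N (v j)"
        using norm_diff_le[OF u(1) v(1)] by (simp add: e_def)
      also have "\<dots> \<le> C * \<delta>"
        using u(2)[of j] v(2)[of j] suminf_mult2[OF a, of \<delta>] suminf_mult2[OF b_Suc, of \<delta>]
        by (simp add: C_def distrib_right)
      finally show ?thesis using \<open>C * \<delta> < \<epsilon>\<close> by simp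
    qed
    then show ?thesis
      using e[of 0] by (intro bexI[of _ "e 0"]) (simp_all add: orbit)
  qed
  with \<open>\<delta> > 0\<close> show "\<exists>\<delta>>0. \<forall>x. (\<forall>j. x j \<in> X) \<and> (\<forall>j. N (T (x j) - x (j + 1)) \<le> \<delta>) \<longrightarrow>
      (\<exists>y\<in>X. \<forall>j. N (x j - int_iterate_on X T j y) < \<epsilon>)"
    by blast
qed

end

section \<open>Suprema of the iterated weights\<close>

lemma sup_norm_on_nonneg:
  assumes "bdd_above (range (\<lambda>x. norm (\<phi> x)))"
  shows "0 \<le> sup_norm_on B \<phi>"
proof (cases "B = {}")
  case False
  then obtain x where "x \<in> B" by blast
  have "bdd_above ((\<lambda>x. norm (\<phi> x)) ` B)"
    using assms by (rule bdd_above_mono) auto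
  then have "norm (\<phi> x) \<le> sup_norm_on B \<phi>"
    using cSUP_upper[OF \<open>x \<in> B\<close>, of "\<lambda>x. norm (\<phi> x)"] False by (simp add: sup_norm_on_def)
  then show ?thesis
    using norm_ge_zero order_trans by blast
qed (simp add: sup_norm_on_def)

lemma sup_norm_on_mono:
  assumes "bdd_above (range (\<lambda>x. norm (\<phi> x)))" "A \<subseteq> B"
  shows "sup_norm_on A \<phi> \<le> sup_norm_on B \<phi>"
proof (cases "A = {}")
  case True
  then show ?thesis
    using sup_norm_on_nonneg[OF assms(1)] by (simp add: sup_norm_on_def)
next
  case False
  have "bdd_above ((\<lambda>x. norm (\<phi> x)) ` B)"
    using assms(1) by (rule bdd_above_mono) auto
  then show ?thesis
    using assms(2) False by (auto simp: sup_norm_on_def intro!: cSUP_subset_mono)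
qed

lemma supp_mult_subset: "supp (\<lambda>x. \<rho> x * \<phi> x) \<subseteq> supp (\<rho> :: _ \<Rightarrow> 'k::mult_zero)"
  unfolding supp_def by (intro closure_mono) auto

text \<open>
  Without boundedness the suprema in the norm estimates would be unspecified and in particular not
  monotone in the set. The lower bound on \<open>w\<close> is what controls the negative iterates.
\<close>

lemma (in invertible_system) bdd_above_weight_iter:
  "bdd_above (range (\<lambda>x. norm (weight_iter f w n x)))"
proof -
  obtain M where M: "norm (w x) \<le> M" for x
    using weight_sup by (auto simp: bdd_above_def)
  define m where "m = (INF x. norm (w x))"
  have m: "m > 0" "m \<le> norm (w x)" for x
    using weight_inf by (auto simp: m_def intro!: cINF_lower bdd_belowI[of _ 0])
  have "M \<ge> 0"
    using M norm_ge_zero order_trans by blast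
  then have "norm (weight_pos f w k x) \<le> M ^ k" for k x
    by (induction k) (auto simp: norm_mult intro!: mult_mono M)
  moreover have "norm (weight_neg f w k x) \<le> (1 / m) ^ k" for k x
  proof (induction k)
    case (Suc k)
    have "norm (1 / w y) \<le> 1 / m" for y
      using m(1) m(2)[of y] by (simp add: norm_divide frac_le)
    with Suc show ?case
      unfolding weight_neg.simps norm_mult power_Suc using m by (intro mult_mono) auto
  qed simp
  ultimately have "norm (weight_iter f w n x) \<le> max (M ^ nat n) ((1 / m) ^ nat (- n))" for x
    by (simp add: weight_iter_def le_max_iff_disj)
  then show ?thesis
    by (rule bdd_above.I2)
qed

text \<open>
  The index \<open>n = 0\<close>, where \<open>root\<close> takes the value \<open>0\<close>, does not affect the limit.
\<close>

lemma summable_of_root_tendsto: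
  fixes c :: "nat \<Rightarrow> real"
  assumes "\<And>n. 0 \<le> c n" "(\<lambda>n. root n (c n)) \<longlonglongrightarrow> L" "L < 1"
  shows "summable c"
proof -
  have "limsup (\<lambda>n. ereal (root n (norm (c n)))) = ereal L"
    using assms by (intro lim_imp_Limsup) auto
  with assms(3) show ?thesis
    by (intro root_test_convergence'[where f = c]) auto
qed

section \<open>Weighted composition operators\<close>

theorem theorem22:
  fixes f :: "'a::t2_space \<Rightarrow> 'a"
    and w :: "'a \<Rightarrow> 'k::real_normed_field"
    and X :: "('a \<Rightarrow> 'k) set"
    and N :: "('a \<Rightarrow> 'k) \<Rightarrow> real"
    and \<rho>m \<rho>p :: "'a \<Rightarrow> 'k"
  assumes "invertible_system f w"
    and "banach_function_space X N"
    and A1: "invertible_operator_on fun_scale X N (weighted_comp w f)"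
    and A2: "\<And>\<phi> n. \<phi> \<in> X \<Longrightarrow>
      N (int_iterate_on X (weighted_comp w f) n \<phi>)
        \<le> sup_norm_on (int_iterate_on UNIV f (- n) ` supp \<phi>) (weight_iter f w n) * N \<phi>"
    and A3: "\<And>\<phi>. \<phi> \<in> X \<Longrightarrow> (\<lambda>x. \<rho>m x * \<phi> x) \<in> X \<and> N (\<lambda>x. \<rho>m x * \<phi> x) \<le> N \<phi>"
      "\<And>\<phi>. \<phi> \<in> X \<Longrightarrow> (\<lambda>x. \<rho>p x * \<phi> x) \<in> X \<and> N (\<lambda>x. \<rho>p x * \<phi> x) \<le> N \<phi>"
      "\<And>x. \<rho>m x + \<rho>p x = 1"
    and "(\<exists>L<1. (\<lambda>n. root n (sup_norm_on UNIV (weight_iter f w (int n)))) \<longlonglongrightarrow> L)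
      \<or> (\<exists>L<1. (\<lambda>n. root n (sup_norm_on UNIV (weight_iter f w (- int n)))) \<longlonglongrightarrow> L)
      \<or> (\<exists>L<1. (\<lambda>n. root n (sup_norm_on (int_iterate_on UNIV f (- int n) ` supp \<rho>m)
                (weight_iter f w (int n)))) \<longlonglongrightarrow> L)
        \<and> (\<exists>L<1. (\<lambda>n. root n (sup_norm_on (int_iterate_on UNIV f (int n) ` supp \<rho>p)
                (weight_iter f w (- int n)))) \<longlonglongrightarrow> L)"
  shows "shadowing_property_on X N (weighted_comp w f)"
proof -
  interpret invertible_system f w by fact
  interpret banach_function_space X N by fact
  interpret invertible_banach_operator fun_scale X N "weighted_comp w f"
    using A1 by unfold_locales
  let ?T = "weighted_comp w f"
  let ?a = "\<lambda>B n. sup_norm_on (int_iterate_on UNIV f (- int n) ` B) (weight_iter f w (int n))"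
  let ?b = "\<lambda>B n. sup_norm_on (int_iterate_on UNIV f (int n) ` B) (weight_iter f w (- int n))"
  note weight_nonneg = sup_norm_on_nonneg[OF bdd_above_weight_iter]
  \<comment> \<open>The set \<open>B\<close> stands for a bound on all supports at once, so that the factor depends on \<open>n\<close>
    alone; \<open>C\<close> allows for the norm of the function before its multiplication by \<open>\<rho>m\<close> or \<open>\<rho>p\<close>.\<close>
  have iterate_le: "N (int_iterate_on X ?T n \<phi>)
      \<le> sup_norm_on (int_iterate_on UNIV f (- n) ` B) (weight_iter f w n) * C"
    if "\<phi> \<in> X" "supp \<phi> \<subseteq> B" "N \<phi> \<le> C" for n \<phi> B C
  proof -
    have "sup_norm_on (int_iterate_on UNIV f (- n) ` supp \<phi>) (weight_iter f w n) * N \<phi>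
        \<le> sup_norm_on (int_iterate_on UNIV f (- n) ` B) (weight_iter f w n) * C"
      using that by (intro mult_mono sup_norm_on_mono bdd_above_weight_iter image_mono
          weight_nonneg norm_nonneg)
    with A2[OF that(1)] show ?thesis
      using order_trans by blast
  qed
  have forward: "N ((?T ^^ n) \<phi>) \<le> ?a B n * C"
    and backward: "N ((inv_into X ?T ^^ n) \<phi>) \<le> ?b B n * C"
    if "\<phi> \<in> X" "supp \<phi> \<subseteq> B" "N \<phi> \<le> C" for n \<phi> B C
    using iterate_le[OF that, of "int n"] iterate_le[OF that, of "- int n"]
    unfolding int_iterate_on_int int_iterate_on_minus_int minus_minus by auto
  \<comment> \<open>Makes the global suprema the case \<open>B = UNIV\<close> of the suprema over images of \<open>B\<close>.\<close>
  have f_onto: "int_iterate_on UNIV f n ` UNIV = UNIV" for n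
  proof -
    have "bij f"
      using homeo unfolding homeomorphism_def bij_def by (metis UNIV_I inj_on_inverseI)
    then show ?thesis
      by (simp add: int_iterate_on_def bij_imp_bij_inv bij_is_surj bij_fn)
  qed
  consider (A) L where "L < 1" "(\<lambda>n. root n (?a UNIV n)) \<longlonglongrightarrow> L"
    | (B) L where "L < 1" "(\<lambda>n. root n (?b UNIV n)) \<longlonglongrightarrow> L"
    | (C) L L' where "L < 1" "(\<lambda>n. root n (?a (supp \<rho>m) n)) \<longlonglongrightarrow> L"
        "L' < 1" "(\<lambda>n. root n (?b (supp \<rho>p) n)) \<longlonglongrightarrow> L'"
    using assms(8) unfolding f_onto by blast
  then show ?thesis
  proof cases
    case A
    show ?thesis
    proof (rule shadowing_of_summable_splitting[where P = id and Q = "\<lambda>_. 0"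
          and a = "?a UNIV" and b = "\<lambda>_. 0"])
      show "summable (?a UNIV)"
        by (rule summable_of_root_tendsto[OF weight_nonneg A(2,1)])
      show "N ((inv_into X ?T ^^ n) 0) \<le> 0 * N \<phi>" for n \<phi>
        using backward[of 0 UNIV 0 n] by (simp add: carrier_zero norm_zero)
    qed (auto simp: carrier_zero weight_nonneg intro!: forward)
  next
    case B
    show ?thesis
    proof (rule shadowing_of_summable_splitting[where P = "\<lambda>_. 0" and Q = id
          and a = "\<lambda>_. 0" and b = "?b UNIV"])
      show "summable (?b UNIV)"
        by (rule summable_of_root_tendsto[OF weight_nonneg B(2,1)])
      show "N ((?T ^^ n) 0) \<le> 0 * N \<phi>" for n \<phi>
        using forward[of 0 UNIV 0 n] by (simp add: carrier_zero norm_zero)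
    qed (auto simp: carrier_zero weight_nonneg intro!: backward)
  next
    case C
    show ?thesis
    proof (rule shadowing_of_summable_splitting[where P = "\<lambda>\<phi> x. \<rho>m x * \<phi> x"
          and Q = "\<lambda>\<phi> x. \<rho>p x * \<phi> x" and a = "?a (supp \<rho>m)" and b = "?b (supp \<rho>p)"])
      show "summable (?a (supp \<rho>m))"
        by (rule summable_of_root_tendsto[OF weight_nonneg C(2,1)])
      show "summable (?b (supp \<rho>p))"
        by (rule summable_of_root_tendsto[OF weight_nonneg C(4,3)])
      show "(\<lambda>x. \<rho>m x * \<phi> x) + (\<lambda>x. \<rho>p x * \<phi> x) = \<phi>" for \<phi>
        using A3(3) by (simp add: fun_eq_iff distrib_right[symmetric])
    qed (intro weight_nonneg forward backward supp_mult_subset conjunct1[OF A3(1)]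
        conjunct2[OF A3(1)] conjunct1[OF A3(2)] conjunct2[OF A3(2)]; assumption)+
  qed
qed

end
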